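(* There is an absolute constant $c>0$ such that for every integer $\Delta\geq 2$ there exist connected graphs $G$ of maximum degree $\Delta$ with arbitrarily large neighbor-locating chromatic number $k=\chi_{NL}(G)$ whose order $n$ satisfies $n \geq c\,\Delta\left(\frac{k}{\Delta-1} \right)^{\Delta+1}$, i.e. $n=\Omega\left(\Delta\left(\frac{k}{\Delta-1} \right)^{\Delta+1}\right)$.
   Context: All graphs are finite and simple. For a proper $k$-coloring $f$ of $G$ and a vertex $x$, let $N_f(x)=\{f(y): y \text{ adjacent to } x\}$. Two vertices $x,y$ are neighbor-distinguished if $f(x)\neq f(y)$ or $N_f(x)\neq N_f(y)$; $f$ is a neighbor-locating $k$-coloring if every two distinct vertices are neighbor-distinguished. The neighbor-locating chromatic number $\chi_{NL}(G)$ is the minimum $k$ for which $G$ admits a neighbor-locating $k$-coloring. *)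

theory Defs
  imports Complex_Main "Graph_Theory.Graph_Theory"
begin

(* A finite simple graph is a symmetric loop-free digraph (locale pair_graph): an edge xy is
   the pair of arcs (x, y) and (y, x), so the degree of a vertex is its out-degree. *)

definition max_degree :: "'a pair_pre_digraph \<Rightarrow> nat" where
  "max_degree G = Max (out_degree (with_proj G) ` pverts G)"

definition proper_coloring :: "'a pair_pre_digraph \<Rightarrow> nat \<Rightarrow> ('a \<Rightarrow> nat) \<Rightarrow> bool" where
  "proper_coloring G k f \<longleftrightarrow>
     f ` pverts G \<subseteq> {1..k} \<and> (\<forall>x y. (x, y) \<in> parcs G \<longrightarrow> f x \<noteq> f y)"

definition neighbor_colors :: "'a pair_pre_digraph \<Rightarrow> ('a \<Rightarrow> nat) \<Rightarrow> 'a \<Rightarrow> nat set" where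
  "neighbor_colors G f x = {f y | y. (x, y) \<in> parcs G}"

definition neighbor_distinguished ::
    "'a pair_pre_digraph \<Rightarrow> ('a \<Rightarrow> nat) \<Rightarrow> 'a \<Rightarrow> 'a \<Rightarrow> bool" where
  "neighbor_distinguished G f x y \<longleftrightarrow>
     f x \<noteq> f y \<or> neighbor_colors G f x \<noteq> neighbor_colors G f y"

definition neighbor_locating_coloring ::
    "'a pair_pre_digraph \<Rightarrow> nat \<Rightarrow> ('a \<Rightarrow> nat) \<Rightarrow> bool" where
  "neighbor_locating_coloring G k f \<longleftrightarrow> proper_coloring G k f \<and>
     (\<forall>x\<in>pverts G. \<forall>y\<in>pverts G. x \<noteq> y \<longrightarrow> neighbor_distinguished G f x y)"

(* For a finite loop-free G the minimum exists, as an injective coloring is neighbor-locating. *)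
definition nl_chromatic_number :: "'a pair_pre_digraph \<Rightarrow> nat" where
  "nl_chromatic_number G = (LEAST k. \<exists>f. neighbor_locating_coloring G k f)"

end

theory Submission
  imports Defs
begin

text \<open>
  In a disjoint union of copies of the complete graph on the vertices \<open>0, \<dots>, \<Delta>\<close>, indexed by
  the numbers \<open>a < m\<^bsup>\<Delta>+1\<^esup>\<close>, color vertex \<open>t\<close> of copy \<open>a\<close> by the pair of \<open>t\<close> and
  the \<open>t\<close>-th digit of \<open>a\<close> in base \<open>m\<close>. Every closed neighborhood then shows all digits of
  \<open>a\<close>, so these \<open>(\<Delta> + 1) m\<close> colors are neighbor-locating. To connect the copies, replace the
  edge between the vertices \<open>\<Delta> - 1\<close> and \<open>\<Delta>\<close> of each copy by an edge from vertex \<open>\<Delta> - 1\<close> of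
  copy \<open>a\<close> to vertex \<open>\<Delta>\<close> of copy \<open>a + 1\<close>. These vertices carry the two top digits, and the
  lower digits of \<open>a\<close> and of \<open>a + 1\<close> determine each other, so \<open>a\<close> can still be
  recovered. The order \<open>(\<Delta> + 1) m\<^bsup>\<Delta>+1\<^esup>\<close> is within a constant of the claimed bound because
  \<open>((\<Delta> + 1) / (\<Delta> - 1))\<^bsup>\<Delta>+1\<^esup> \<le> exp 6\<close>; and the neighbor-locating chromatic number is
  large because a graph for which it is \<open>k\<close> has order at most \<open>k 2\<^bsup>k\<^esup>\<close>.
\<close>

section \<open>Neighbor-locating colorings\<close>

lemma nl_chromatic_number_le:
  assumes "neighbor_locating_coloring G k f"
  shows "nl_chromatic_number G \<le> k"
  unfolding nl_chromatic_number_def using assms by (blast intro: Least_le)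

lemma nl_chromatic_number_attained:
  assumes "neighbor_locating_coloring G k f"
  shows "\<exists>f. neighbor_locating_coloring G (nl_chromatic_number G) f"
  unfolding nl_chromatic_number_def by (rule LeastI) (use assms in blast)

text \<open>A vertex is identified by its color together with its set of neighbor colors. Hence
  large order forces a large neighbor-locating chromatic number.\<close>

lemma card_verts_le_of_neighbor_locating_coloring:
  assumes f: "neighbor_locating_coloring G k f"
    and wf: "pair_wf_digraph G"
  shows "card (pverts G) \<le> k * 2 ^ k"
proof -
  have col: "f x \<in> {1..k}" if "x \<in> pverts G" for x
    using f that by (auto simp: neighbor_locating_coloring_def proper_coloring_def)
  have nbr: "neighbor_colors G f x \<subseteq> {1..k}" for x
    unfolding neighbor_colors_def using pair_wf_digraph.in_arcsD2[OF wf] col by blast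
  have "inj_on (\<lambda>x. (f x, neighbor_colors G f x)) (pverts G)"
    using f by (auto simp: neighbor_locating_coloring_def neighbor_distinguished_def inj_on_def)
  moreover have "(\<lambda>x. (f x, neighbor_colors G f x)) ` pverts G \<subseteq> {1..k} \<times> Pow {1..k}"
    using col nbr by (intro image_subsetI SigmaI PowI)
  ultimately have "card (pverts G) \<le> card ({1..k} \<times> Pow {1..k})"
    by (intro card_inj_on_le[of "\<lambda>x. (f x, neighbor_colors G f x)"]) auto
  then show ?thesis by (simp add: card_cartesian_product card_Pow)
qed

section \<open>Digits\<close>

lemma mod_power_Suc_eq_iff:
  fixes a b m :: nat
  assumes "m > 0"
  shows "a mod m ^ Suc i = b mod m ^ Suc i \<longleftrightarrow>
    a mod m ^ i = b mod m ^ i \<and> a div m ^ i mod m = b div m ^ i mod m"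
proof -
  have decomp: "x mod m ^ Suc i = m ^ i * (x div m ^ i mod m) + x mod m ^ i" for x
    using mod_mult2_eq[of x "m ^ i" m] by (simp add: mult.commute)
  have "m ^ i > 0" using assms by simp
  have low: "x mod m ^ Suc i mod m ^ i = x mod m ^ i" for x
    by (simp add: mod_mod_cancel)
  have high: "x mod m ^ Suc i div m ^ i = x div m ^ i mod m" for x
    using \<open>m ^ i > 0\<close> by (simp add: decomp del: power_Suc)
  show ?thesis
  proof
    assume "a mod m ^ Suc i = b mod m ^ Suc i"
    then show "a mod m ^ i = b mod m ^ i \<and> a div m ^ i mod m = b div m ^ i mod m"
      using low[of a] low[of b] high[of a] high[of b] by argo
  qed (simp add: decomp del: power_Suc)
qed

lemma mod_power_eq_of_digits_eq:
  fixes a b m :: nat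
  assumes "m > 0" "\<And>i. i < k \<Longrightarrow> a div m ^ i mod m = b div m ^ i mod m"
  shows "a mod m ^ k = b mod m ^ k"
  using assms(2) by (induction k) (simp_all add: mod_power_Suc_eq_iff[OF assms(1)] del: power_Suc)

text \<open>This moves equality of low digits between consecutive copies of the chain, whatever
  carries occur.\<close>

lemma Suc_mod_eq_iff:
  fixes a b n :: nat
  shows "Suc a mod n = Suc b mod n \<longleftrightarrow> a mod n = b mod n"
proof
  assume "Suc a mod n = Suc b mod n"
  then have "(int a + 1) mod int n = (int b + 1) mod int n"
    by (metis of_nat_Suc of_nat_mod add.commute)
  then have "(int a + 1 - 1) mod int n = (int b + 1 - 1) mod int n"
    by (rule mod_diff_cong) simp
  then show "a mod n = b mod n" by (simp flip: of_nat_mod)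
qed (metis mod_Suc_eq)

section \<open>A chain of cliques\<close>

definition vertex :: "nat \<Rightarrow> nat \<Rightarrow> nat \<Rightarrow> nat" where
  "vertex d t a = a * Suc d + t"

text \<open>For distinct \<open>s\<close> and \<open>t\<close> up to \<open>d\<close>, the second
  branch concerns only positions \<open>d - 1\<close> and \<open>d\<close>: position
  \<open>d\<close> of a copy meets position \<open>d - 1\<close> of the preceding copy.\<close>

definition linked :: "nat \<Rightarrow> nat \<Rightarrow> nat \<Rightarrow> nat \<Rightarrow> nat \<Rightarrow> bool" where
  "linked d s a t b \<longleftrightarrow> s \<noteq> t \<and>
     (if s < d - 1 \<or> t < d - 1 then a = b else if s = d then a = Suc b else b = Suc a)"

definition clique_chain :: "nat \<Rightarrow> nat \<Rightarrow> nat pair_pre_digraph" where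
  "clique_chain d l = \<lparr> pverts = {..<l * Suc d},
     parcs = {(v, w). v < l * Suc d \<and> w < l * Suc d \<and>
       linked d (v mod Suc d) (v div Suc d) (w mod Suc d) (w div Suc d)} \<rparr>"

lemma vertex_mod [simp]: "t \<le> d \<Longrightarrow> vertex d t a mod Suc d = t"
  and vertex_div [simp]: "t \<le> d \<Longrightarrow> vertex d t a div Suc d = a"
  by (simp_all add: vertex_def del: mult_Suc_right)

lemma vertex_less_iff [simp]: "t \<le> d \<Longrightarrow> vertex d t a < l * Suc d \<longleftrightarrow> a < l"
  using less_mult_imp_div_less[of "vertex d t a" l "Suc d"] div_less_iff_less_mult[of "Suc d" "vertex d t a" l]
  by simp

lemma vertexE:
  obtains t a where "t \<le> d" "v = vertex d t a"
proof
  show "v mod Suc d \<le> d" using mod_less_divisor[of "Suc d" v] by linarith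
  show "v = vertex d (v mod Suc d) (v div Suc d)"
    unfolding vertex_def by (rule div_mult_mod_eq[symmetric])
qed

lemma pverts_clique_chain: "pverts (clique_chain d l) = {..<l * Suc d}"
  by (simp add: clique_chain_def)

lemma vertex_in_pverts [simp]: "t \<le> d \<Longrightarrow> vertex d t a \<in> pverts (clique_chain d l) \<longleftrightarrow> a < l"
  unfolding pverts_clique_chain lessThan_iff by (rule vertex_less_iff)

lemma arc_clique_chain_iff [simp]:
  "s \<le> d \<Longrightarrow> t \<le> d \<Longrightarrow>
    (vertex d s a, vertex d t b) \<in> parcs (clique_chain d l) \<longleftrightarrow> a < l \<and> b < l \<and> linked d s a t b"
  unfolding clique_chain_def by (simp del: mult_Suc_right)

lemma linked_sym: "s \<le> d \<Longrightarrow> t \<le> d \<Longrightarrow> linked d s a t b \<Longrightarrow> linked d t b s a"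
  by (auto simp: linked_def split: if_splits)

lemma pair_graph_clique_chain: "pair_graph (clique_chain d l)"
proof
  show "finite (parcs (clique_chain d l))"
    by (rule finite_subset[of _ "{..<l * Suc d} \<times> {..<l * Suc d}"])
      (auto simp: clique_chain_def)
  show "symmetric (with_proj (clique_chain d l))"
    unfolding symmetric_def with_proj_simps
  proof (rule symI)
    fix v w assume "(v, w) \<in> parcs (clique_chain d l)"
    then show "(w, v) \<in> parcs (clique_chain d l)"
      by (cases v rule: vertexE[of d]; cases w rule: vertexE[of d]) (auto intro: linked_sym)
  qed
qed (auto simp: clique_chain_def linked_def)

text \<open>Position 0 lies below \<open>d - 1\<close>, so it is adjacent to its whole copy; the
  rerouted edge leads from each copy to the preceding one.\<close>

lemma connected_clique_chain:
  assumes "d \<ge> 2" "l > 0"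
  shows "Digraph_Component.connected (with_proj (clique_chain d l))"
proof -
  let ?G = "clique_chain d l"
  interpret pair_graph ?G by (rule pair_graph_clique_chain)
  have to_first: "vertex d t a \<rightarrow>\<^sup>*\<^bsub>with_proj ?G\<^esub> vertex d 0 a" if "t \<le> d" "a < l" for t a
  proof (cases "t = 0")
    case False
    then show ?thesis using that assms
      by (intro reachable_adjI) (simp add: linked_def)
  qed (use that in simp)
  have from_first: "vertex d 0 a \<rightarrow>\<^sup>*\<^bsub>with_proj ?G\<^esub> vertex d t a" if "t \<le> d" "a < l" for t a
    using symmetric_reachable'[OF to_first[OF that]] .
  have first: "vertex d 0 a \<rightarrow>\<^sup>*\<^bsub>with_proj ?G\<^esub> vertex d 0 0" if "a < l" for a
    using that
  proof (induction a)
    case (Suc a)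
    have "vertex d 0 (Suc a) \<rightarrow>\<^sup>*\<^bsub>with_proj ?G\<^esub> vertex d d (Suc a)"
      using Suc.prems by (intro from_first) auto
    also have "vertex d d (Suc a) \<rightarrow>\<^sup>*\<^bsub>with_proj ?G\<^esub> vertex d (d - 1) a"
      using Suc.prems assms by (intro reachable_adjI) (auto simp: linked_def)
    also have "vertex d (d - 1) a \<rightarrow>\<^sup>*\<^bsub>with_proj ?G\<^esub> vertex d 0 a"
      using Suc.prems by (intro to_first) auto
    also have "vertex d 0 a \<rightarrow>\<^sup>*\<^bsub>with_proj ?G\<^esub> vertex d 0 0"
      using Suc by simp
    finally show ?case .
  qed simp
  have root: "v \<rightarrow>\<^sup>*\<^bsub>with_proj ?G\<^esub> vertex d 0 0" if "v \<in> pverts ?G" for v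
    using that reachable_trans[OF to_first first] by (cases v rule: vertexE[of d]) auto
  have "u \<rightarrow>\<^sup>*\<^bsub>with_proj ?G\<^esub> v" if "u \<in> pverts ?G" "v \<in> pverts ?G" for u v
    using reachable_trans[OF root[OF that(1)] symmetric_reachable'[OF root[OF that(2)]]] .
  moreover have "pverts ?G \<noteq> {}"
    using assms by (auto simp: pverts_clique_chain)
  ultimately show ?thesis
    unfolding Digraph_Component.connected_def strongly_connected_def
    using reachable_mk_symmetric_eq[OF pair_sym_arcs] by simp
qed

lemma max_degree_clique_chain:
  assumes "d \<ge> 2" "l > 0"
  shows "max_degree (clique_chain d l) = d"
proof -
  let ?G = "clique_chain d l"
  have le: "out_degree (with_proj ?G) v \<le> d" for v
  proof -
    obtain t a where v: "t \<le> d" "v = vertex d t a" by (rule vertexE)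
    \<comment> \<open>The position of a neighbor fixes its copy, so counting neighbors amounts to
      counting positions other than \<open>t\<close>.\<close>
    have inj: "inj_on (\<lambda>e. snd e mod Suc d) (out_arcs (with_proj ?G) v)"
    proof (rule inj_onI)
      fix e e' assume e: "e \<in> out_arcs (with_proj ?G) v" "e' \<in> out_arcs (with_proj ?G) v"
        and eq: "snd e mod Suc d = snd e' mod Suc d"
      obtain s b where w: "s \<le> d" "snd e = vertex d s b" by (rule vertexE)
      obtain s' b' where w': "s' \<le> d" "snd e' = vertex d s' b'" by (rule vertexE)
      have "s' = s" using eq w w' by simp
      moreover have "e = (v, snd e)" "e' = (v, snd e')"
        using e by (auto simp: out_arcs_def prod_eq_iff)
      then have "linked d t a s b" "linked d t a s' b'"
        using e v w w' by (auto simp: out_arcs_def)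
      ultimately have "b' = b" by (auto simp: linked_def split: if_splits)
      with \<open>s' = s\<close> w w' \<open>e = _\<close> \<open>e' = _\<close> show "e = e'" by metis
    qed
    have "(\<lambda>e. snd e mod Suc d) ` out_arcs (with_proj ?G) v \<subseteq> {..d} - {t}"
    proof (rule image_subsetI)
      fix e assume e: "e \<in> out_arcs (with_proj ?G) v"
      obtain s b where w: "s \<le> d" "snd e = vertex d s b" by (rule vertexE)
      have "e = (v, snd e)" using e by (auto simp: out_arcs_def prod_eq_iff)
      then have "linked d t a s b" using e v w by (auto simp: out_arcs_def)
      then show "snd e mod Suc d \<in> {..d} - {t}" using w by (auto simp: linked_def)
    qed
    from card_inj_on_le[OF inj this] v(1) show ?thesis by (simp add: out_degree_def)
  qed
  \<comment> \<open>Position 0 keeps all its clique edges and attains the bound, while the two ends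
    of the chain lack a rerouted edge.\<close>
  have "d = card ((\<lambda>t. (vertex d 0 0, vertex d t 0)) ` {1..d})"
    by (subst card_image) (auto simp: inj_on_def vertex_def)
  also have "\<dots> \<le> out_degree (with_proj ?G) (vertex d 0 0)"
    unfolding out_degree_def
    using assms pair_fin_digraph.pair_finite_arcs[of ?G] pair_graph_clique_chain[of d l]
    by (intro card_mono)
      (auto simp: out_arcs_def linked_def pair_graph_def pair_digraph_def)
  finally have "out_degree (with_proj ?G) (vertex d 0 0) = d" using le by (metis le_antisym)
  moreover have "vertex d 0 0 \<in> pverts ?G" using assms by simp
  ultimately have "d \<in> out_degree (with_proj ?G) ` pverts ?G" by (metis image_eqI)
  then show ?thesis
    unfolding max_degree_def using le
    by (intro Max_eqI) (auto simp: pverts_clique_chain)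
qed

section \<open>The digit coloring\<close>

text \<open>Position \<open>t\<close> owns the block of \<open>m\<close> colors following
  \<open>t * m\<close>; the final 1 makes the colors start at 1.\<close>

definition digit_coloring :: "nat \<Rightarrow> nat \<Rightarrow> nat \<Rightarrow> nat" where
  "digit_coloring d m v = (v mod Suc d) * m + (v div Suc d) div m ^ (v mod Suc d) mod m + 1"

lemma digit_coloring_vertex:
  "t \<le> d \<Longrightarrow> digit_coloring d m (vertex d t a) = t * m + a div m ^ t mod m + 1"
  by (simp add: digit_coloring_def)

lemma digit_coloring_eq_iff:
  assumes "m > 0" "s \<le> d" "t \<le> d"
  shows "digit_coloring d m (vertex d s a) = digit_coloring d m (vertex d t b) \<longleftrightarrow>
    s = t \<and> a div m ^ s mod m = b div m ^ t mod m"
proof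
  assume "digit_coloring d m (vertex d s a) = digit_coloring d m (vertex d t b)"
  then have eq: "s * m + a div m ^ s mod m = t * m + b div m ^ t mod m"
    using assms by (simp add: digit_coloring_vertex)
  \<comment> \<open>Digits are below \<open>m\<close>, so division by \<open>m\<close> reads off the
    position.\<close>
  from arg_cong[OF eq, of "\<lambda>x. x div m"] have "s = t" using assms(1) by simp
  with eq show "s = t \<and> a div m ^ s mod m = b div m ^ t mod m" by simp
qed (use assms in \<open>auto simp: digit_coloring_vertex\<close>)

lemma neighbor_locating_digit_coloring:
  assumes d: "d \<ge> 2" and m: "m > 0"
  shows "neighbor_locating_coloring (clique_chain d (m ^ Suc d)) (Suc d * m) (digit_coloring d m)"
proof -
  let ?l = "m ^ Suc d"
  let ?G = "clique_chain d ?l" and ?f = "digit_coloring d m"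
  have range: "?f v \<in> {1..Suc d * m}" for v
  proof -
    obtain t a where v: "t \<le> d" "v = vertex d t a" by (rule vertexE)
    have "a div m ^ t mod m < m" "t * m \<le> d * m" using v m by auto
    then have "t * m + a div m ^ t mod m + 1 \<le> Suc d * m" by (simp only: mult_Suc)
    then show ?thesis using v by (simp add: digit_coloring_vertex)
  qed
  have proper: "?f v \<noteq> ?f w" if "(v, w) \<in> parcs ?G" for v w
    using that m
    by (cases v rule: vertexE[of d]; cases w rule: vertexE[of d])
      (auto simp: digit_coloring_eq_iff linked_def simp del: power_Suc)
  \<comment> \<open>Colors reveal positions, so equal neighbor color sets must agree position by
    position.\<close>
  have transfer: "\<exists>b'. b' < ?l \<and> linked d t a' s b' \<and> b div m ^ s mod m = b' div m ^ s mod m"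
    if N: "neighbor_colors ?G ?f (vertex d t a) = neighbor_colors ?G ?f (vertex d t a')"
      and le: "t \<le> d" "s \<le> d" "a < ?l" "b < ?l" and link: "linked d t a s b"
    for t s a a' b
  proof -
    have "?f (vertex d s b) \<in> neighbor_colors ?G ?f (vertex d t a)"
      using le link by (auto simp: neighbor_colors_def simp del: power_Suc)
    then obtain w where w: "(vertex d t a', w) \<in> parcs ?G" "?f (vertex d s b) = ?f w"
      unfolding N by (auto simp: neighbor_colors_def)
    then show ?thesis using le m
      by (cases w rule: vertexE[of d]) (auto simp: digit_coloring_eq_iff simp del: power_Suc)
  qed
  have locate: "a = a'"
    if t: "t \<le> d" and a: "a < ?l" "a' < ?l"
      and own: "a div m ^ t mod m = a' div m ^ t mod m"
      and N: "neighbor_colors ?G ?f (vertex d t a) = neighbor_colors ?G ?f (vertex d t a')"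
    for t a a'
  proof -
    \<comment> \<open>Edges touching a position below \<open>d - 1\<close> stay inside the copy and
      therefore show digits of the same number.\<close>
    have same: "a div m ^ s mod m = a' div m ^ s mod m" if "s \<le> d" "s < d - 1 \<or> t < d - 1" for s
    proof (cases "s = t")
      case False
      then have "linked d t a s a" using that by (auto simp: linked_def)
      from transfer[OF N t that(1) a(1) a(1) this] show ?thesis
        using that by (auto simp: linked_def)
    qed (use own in simp)
    have digits_imp_eq: "x = y" if "x < ?l" "y < ?l" "x mod m ^ d = y mod m ^ d"
      "x div m ^ d mod m = y div m ^ d mod m" for x y
      using that mod_power_Suc_eq_iff[OF m, of x d y] by (metis mod_less)
    consider "t < d - 1" | "t = d - 1" | "t = d" using t by linarith
    then show ?thesis
    proof cases
      case 1
      then show ?thesis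
        using mod_power_eq_of_digits_eq[OF m, of "Suc d" a a'] same a by (metis mod_less less_Suc_eq_le)
    next
      \<comment> \<open>Position \<open>d - 1\<close> sees digits 0 to \<open>d - 2\<close> of
        \<open>a\<close> and carries digit \<open>d - 1\<close> itself, but the top digit it sees
        belongs to \<open>Suc a\<close>.\<close>
      case 2
      have low: "a mod m ^ d = a' mod m ^ d"
        using same own 2 by (intro mod_power_eq_of_digits_eq[OF m]) (metis Suc_pred' less_SucE less_imp_le_nat d gr_zeroI not_numeral_le_zero)
      \<comment> \<open>The successors agree in their low \<open>d\<close> digits and, by the
        rerouted edge, in the top digit.\<close>
      have next_eq: "x = y" if "Suc x < ?l" "y < ?l" "x mod m ^ d = y mod m ^ d"
        "neighbor_colors ?G ?f (vertex d t x) = neighbor_colors ?G ?f (vertex d t y)" for x y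
      proof -
        have "linked d t x d (Suc x)" using 2 d by (auto simp: linked_def)
        from transfer[OF that(4) t order_refl _ that(1) this] that(1)
        obtain y' where "y' < ?l" "linked d t y d y'" "Suc x div m ^ d mod m = y' div m ^ d mod m"
          by auto
        moreover from this have "y' = Suc y" using 2 d by (auto simp: linked_def)
        ultimately show "x = y"
          using digits_imp_eq[of "Suc x" "Suc y"] that by (simp add: Suc_mod_eq_iff del: power_Suc)
      qed
      show ?thesis
      \<comment> \<open>The last copy has no successor; if neither number has one, both equal
        \<open>?l - 1\<close>.\<close>
      proof (cases "Suc a < ?l \<or> Suc a' < ?l")
        case True
        then show ?thesis using next_eq[of a a'] next_eq[of a' a] a low N by auto
      qed (use a in linarith)
    next
      \<comment> \<open>Position \<open>d\<close> sees digits 0 to \<open>d - 2\<close> of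
        \<open>a\<close> and carries the top digit, but digit \<open>d - 1\<close> comes from the
        predecessor. So the low \<open>d\<close> digits of the predecessors are matched first, then
        those of the numbers themselves.\<close>
      case 3
      have low: "a mod m ^ (d - 1) = a' mod m ^ (d - 1)"
        using same by (intro mod_power_eq_of_digits_eq[OF m]) auto
      have prev: "Suc x = y" if "Suc x < ?l" "y < ?l" "Suc x mod m ^ (d - 1) = y mod m ^ (d - 1)"
        "Suc x div m ^ d mod m = y div m ^ d mod m"
        "neighbor_colors ?G ?f (vertex d t (Suc x)) = neighbor_colors ?G ?f (vertex d t y)" for x y
      proof -
        have "linked d t (Suc x) (d - 1) x" using 3 d by (auto simp: linked_def)
        from transfer[OF that(5) t _ that(1) _ this] that(1)
        obtain y' where y': "linked d t y (d - 1) y'"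
          "x div m ^ (d - 1) mod m = y' div m ^ (d - 1) mod m"
          by auto
        from y'(1) have y: "y = Suc y'" using 3 d by (auto simp: linked_def)
        have "x mod m ^ (d - 1) = y' mod m ^ (d - 1)"
          using that(3) by (simp add: y Suc_mod_eq_iff)
        then have "x mod m ^ d = y' mod m ^ d"
          using y'(2) mod_power_Suc_eq_iff[OF m, of x "d - 1" y'] d by simp
        then show "Suc x = y"
          using that y digits_imp_eq[of "Suc x" y] by (simp add: Suc_mod_eq_iff del: power_Suc)
      qed
      \<comment> \<open>Copy 0 has no predecessor, so \<open>prev\<close> starts from whichever
        number is nonzero.\<close>
      show ?thesis
      proof (cases a)
        case (Suc x)
        then show ?thesis using prev[of x a'] a low own N 3 by simp
      next
        case a0: 0
        show ?thesis
        proof (cases a')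
          case (Suc x)
          then show ?thesis using prev[of x a] a low own N 3 by simp
        qed (use a0 in simp)
      qed
    qed
  qed
  have "neighbor_distinguished ?G ?f v w"
    if vw: "v \<in> pverts ?G" "w \<in> pverts ?G" "v \<noteq> w" for v w
  proof (rule ccontr)
    assume "\<not> neighbor_distinguished ?G ?f v w"
    then have eq: "?f v = ?f w" "neighbor_colors ?G ?f v = neighbor_colors ?G ?f w"
      by (auto simp: neighbor_distinguished_def)
    obtain t a where v: "t \<le> d" "v = vertex d t a" by (rule vertexE)
    obtain s b where w: "s \<le> d" "w = vertex d s b" by (rule vertexE)
    from eq(1) v w m have st: "s = t" "a div m ^ t mod m = b div m ^ t mod m"
      by (auto simp: digit_coloring_eq_iff)
    have "a < ?l" "b < ?l" using vw v w by (simp_all del: power_Suc)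
    from locate[OF v(1) this st(2)] eq(2) have "a = b" by (simp add: v w st(1))
    then show False using vw(3) v w st by simp
  qed
  then show ?thesis
    using range proper unfolding neighbor_locating_coloring_def proper_coloring_def by blast
qed

section \<open>The lower bound on the order\<close>

text \<open>By \<open>1 + x \<le> exp x\<close> the power is at most
  \<open>exp (2 * (d + 1) / (d - 1))\<close>; this exponent decreases in \<open>d\<close> and equals
  6 at \<open>d = 2\<close>.\<close>

lemma ratio_power_le_exp:
  fixes d :: nat
  assumes "d \<ge> 2"
  shows "((real d + 1) / (real d - 1)) ^ Suc d \<le> exp 6"
proof -
  have pos: "real d - 1 > 0" using assms by simp
  have "(real d + 1) / (real d - 1) = 1 + 2 / (real d - 1)"
    using pos by (simp add: field_simps)
  also have "\<dots> \<le> exp (2 / (real d - 1))" by (rule exp_ge_add_one_self)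
  finally have "((real d + 1) / (real d - 1)) ^ Suc d \<le> exp (2 / (real d - 1)) ^ Suc d"
    using pos by (intro power_mono) auto
  also have "\<dots> = exp (real (Suc d) * (2 / (real d - 1)))" by (simp only: exp_of_nat_mult)
  also have "\<dots> \<le> exp 6"
    using pos assms by (simp add: field_simps)
  finally show ?thesis .
qed

text \<open>The left side increases with \<open>k\<close>, so an upper bound on the chromatic number
  suffices; \<open>exp (-6)\<close> absorbs the ratio of \<open>d + 1\<close> to
  \<open>d - 1\<close>.\<close>

lemma order_bound:
  fixes d m k :: nat
  assumes "d \<ge> 2" "k \<le> Suc d * m"
  shows "exp (-6) * real d * (real k / (real d - 1)) ^ (d + 1) \<le> real (m ^ Suc d * Suc d)"
proof -
  have pos: "real d - 1 > 0" using assms by simp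
  have "real k \<le> (real d + 1) * real m"
    using assms(2) by (metis of_nat_Suc of_nat_le_iff of_nat_mult add.commute)
  then have "(real k / (real d - 1)) ^ Suc d \<le> ((real d + 1) / (real d - 1) * real m) ^ Suc d"
    using pos by (intro power_mono) (simp_all add: divide_right_mono)
  also have "\<dots> \<le> exp 6 * real m ^ Suc d"
    unfolding power_mult_distrib using ratio_power_le_exp[OF assms(1)] by (rule mult_right_mono) simp
  finally have "exp (-6) * real d * (real k / (real d - 1)) ^ Suc d
      \<le> exp (-6) * real d * (exp 6 * real m ^ Suc d)"
    by (intro mult_left_mono) auto
  also have "\<dots> = real d * real m ^ Suc d"
    by (simp add: exp_minus)
  also have "\<dots> \<le> real (m ^ Suc d * Suc d)"
    by (simp add: algebra_simps)
  finally show ?thesis by simp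
qed

theorem theorem4:
  shows "\<exists>c::real. c > 0 \<and> (\<forall>\<Delta>::nat. \<Delta> \<ge> 2 \<longrightarrow> (\<forall>K::nat.
    \<exists>G :: nat pair_pre_digraph.
      pair_graph G \<and> Digraph_Component.connected (with_proj G) \<and> max_degree G = \<Delta> \<and>
      nl_chromatic_number G \<ge> K \<and>
      real (card (pverts G))
        \<ge> c * real \<Delta> * (real (nl_chromatic_number G) / (real \<Delta> - 1)) ^ (\<Delta> + 1)))"
proof (intro exI[of _ "exp (-6)"] conjI allI impI)
  fix d K :: nat
  assume d: "d \<ge> 2"
  \<comment> \<open>This \<open>m\<close> exceeds \<open>k * 2 ^ k\<close> for all
    \<open>k \<le> K\<close>, and the order is at least \<open>m\<close>, so the chromatic number
    cannot fall below \<open>K\<close>.\<close>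
  define m where "m = K * 2 ^ K + 1"
  define G where "G = clique_chain d (m ^ Suc d)"
  have m: "m > 0" by (simp add: m_def)
  have card: "card (pverts G) = m ^ Suc d * Suc d"
    by (simp add: G_def pverts_clique_chain)
  have graph: "pair_graph G" unfolding G_def by (rule pair_graph_clique_chain)
  interpret pair_graph G by (rule graph)
  have f: "neighbor_locating_coloring G (Suc d * m) (digit_coloring d m)"
    unfolding G_def using d m by (rule neighbor_locating_digit_coloring)
  from nl_chromatic_number_attained[OF f] obtain g
    where g: "neighbor_locating_coloring G (nl_chromatic_number G) g" ..
  have "K \<le> nl_chromatic_number G"
  proof (rule ccontr)
    assume "\<not> K \<le> nl_chromatic_number G"
    then have "nl_chromatic_number G * 2 ^ nl_chromatic_number G \<le> K * 2 ^ K"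
      by (intro mult_mono) auto
    also have "\<dots> < m" by (simp add: m_def)
    also have "m \<le> m ^ Suc d * Suc d" using m self_le_power[of m "Suc d"] by (simp add: trans_le_add1)
    finally show False
      using card_verts_le_of_neighbor_locating_coloring[OF g] card pair_wf_digraph by simp
  qed
  moreover have "Digraph_Component.connected (with_proj G)" "max_degree G = d"
    unfolding G_def using d m by (simp_all add: connected_clique_chain max_degree_clique_chain)
  ultimately show "\<exists>G :: nat pair_pre_digraph.
      pair_graph G \<and> Digraph_Component.connected (with_proj G) \<and> max_degree G = d \<and>
      nl_chromatic_number G \<ge> K \<and>
      real (card (pverts G))
        \<ge> exp (-6) * real d * (real (nl_chromatic_number G) / (real d - 1)) ^ (d + 1)"
    using graph order_bound[OF d nl_chromatic_number_le[OF f]]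
    unfolding card[symmetric] by (intro exI[of _ G] conjI)
qed simp

end
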